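(* Let $\psi$ be a 2CSP instance on $n$ variables with constant-size alphabet $A$ whose constraint graph is $d$-regular for a constant $d$, and suppose $\mathrm{OPT}(\psi)<1-\eta$ for a constant $\eta>0$. Let $G_\psi=(V,E)$ be the graph constructed below, with $\rho=\sqrt{n}\log\log n$ and $k=\binom{n}{\rho}$. Then there are constants $\epsilon_0>0$ and $\delta>0$ (depending only on $\eta$, $|A|$, $d$) such that, for $n$ sufficiently large, every $S\subseteq V$ of size $k' = k\cdot |V|^{-\epsilon_0/\log\log|V|}$ satisfies $\mathrm{den}(S)<1-\delta$.
   Context: A 2CSP instance $\psi$ consists of a constraint graph on variables $x_1,\dots,x_n$, each edge $(x_i,x_j)$ carrying a constraint $\psi_{i,j}:A\times A\to\{0,1\}$ specifying allowed pairs of labels; $\mathrm{OPT}(\psi)$ is the maximum over assignments $[n]\to A$ of the fraction of satisfied constraints. Construction of $G_\psi$: set $\rho=\sqrt n\log\log n$ and $k=\binom n\rho$. The vertices are all pairs $v=(T,y)$ where $T\subseteq[n]$ is a set of $\rho$ variables and $y:T\to A$ is an assignment to them (so $|V|=\binom n\rho|A|^\rho$). A vertex $v=(T,y)$ violates a 2CSP constraint if some constraint on $(x_i,x_j)$ with $i,j\in T$ is not satisfied by $(y(i),y(j))$; such vertices are isolated. For non-isolated $u=(T,y)$, $v=(T',y')$, the ordered pair $(u,v)$ is in $E$ iff (i) for every shared variable $i\in T\cap T'$, $y(i)=y'(i)$, and (ii) for every constraint on $(x_i,x_j)$ with $i\in T$, $j\in T'$, the pair $(y(i),y'(j))$ satisfies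 it. Density: $\mathrm{den}(S)=\frac{|(S\times S)\cap E|}{|S\times S|}$. Logarithms are base 2. *)

theory Defs
  imports Complex_Main "HOL-Library.FuncSet"
begin

text \<open>A 2CSP instance on variables 0..<n: a set Ec of constraint edges (ordered pairs,
  each constraint listed once), and for each edge (i,j) a constraint psi i j on
  (label of x_i, label of x_j). Labels come from the alphabet A.\<close>

definition csp_wf :: "nat \<Rightarrow> (nat \<times> nat) set \<Rightarrow> bool" where
  "csp_wf n Ec \<longleftrightarrow> Ec \<subseteq> {0..<n} \<times> {0..<n} \<and> (\<forall>(i,j)\<in>Ec. i \<noteq> j \<and> (j,i) \<notin> Ec)"

definition constraint_graph_regular :: "nat \<Rightarrow> (nat \<times> nat) set \<Rightarrow> nat \<Rightarrow> bool" where
  "constraint_graph_regular n Ec d \<longleftrightarrow>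
     (\<forall>i<n. card {j. (i,j) \<in> Ec \<or> (j,i) \<in> Ec} = d)"

definition assignments :: "nat \<Rightarrow> nat set \<Rightarrow> (nat \<Rightarrow> nat) set" where
  "assignments n A = PiE {0..<n} (\<lambda>_. A)"

definition csp_value ::
  "(nat \<times> nat) set \<Rightarrow> (nat \<Rightarrow> nat \<Rightarrow> nat \<Rightarrow> nat \<Rightarrow> bool) \<Rightarrow> (nat \<Rightarrow> nat) \<Rightarrow> real" where
  "csp_value Ec psi \<sigma> =
     real (card {(i,j) \<in> Ec. psi i j (\<sigma> i) (\<sigma> j)}) / real (card Ec)"

definition csp_OPT ::
  "nat \<Rightarrow> nat set \<Rightarrow> (nat \<times> nat) set \<Rightarrow> (nat \<Rightarrow> nat \<Rightarrow> nat \<Rightarrow> nat \<Rightarrow> bool) \<Rightarrow> real" where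
  "csp_OPT n A Ec psi = Max (csp_value Ec psi ` assignments n A)"

definition rho :: "nat \<Rightarrow> nat" where
  "rho n = nat \<lfloor>sqrt (real n) * log 2 (log 2 (real n))\<rfloor>"

type_synonym vertex = "nat set \<times> (nat \<Rightarrow> nat)"

definition G_V :: "nat \<Rightarrow> nat set \<Rightarrow> vertex set" where
  "G_V n A = {(T, y). T \<subseteq> {0..<n} \<and> card T = rho n \<and> y \<in> PiE T (\<lambda>_. A)}"

definition violates ::
  "(nat \<times> nat) set \<Rightarrow> (nat \<Rightarrow> nat \<Rightarrow> nat \<Rightarrow> nat \<Rightarrow> bool) \<Rightarrow> vertex \<Rightarrow> bool" where
  "violates Ec psi v \<longleftrightarrow>
     (\<exists>(i,j)\<in>Ec. i \<in> fst v \<and> j \<in> fst v \<and> \<not> psi i j (snd v i) (snd v j))"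

definition G_E ::
  "nat \<Rightarrow> nat set \<Rightarrow> (nat \<times> nat) set \<Rightarrow> (nat \<Rightarrow> nat \<Rightarrow> nat \<Rightarrow> nat \<Rightarrow> bool) \<Rightarrow> (vertex \<times> vertex) set" where
  "G_E n A Ec psi = {(u, v). u \<in> G_V n A \<and> v \<in> G_V n A \<and>
      \<not> violates Ec psi u \<and> \<not> violates Ec psi v \<and>
      (\<forall>i \<in> fst u \<inter> fst v. snd u i = snd v i) \<and>
      (\<forall>(i,j)\<in>Ec. (i \<in> fst u \<and> j \<in> fst v \<longrightarrow> psi i j (snd u i) (snd v j)) \<and>
                   (j \<in> fst u \<and> i \<in> fst v \<longrightarrow> psi i j (snd v i) (snd u j)))}"

definition den :: "'v set \<Rightarrow> ('v \<times> 'v) set \<Rightarrow> real" where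
  "den S E = real (card ((S \<times> S) \<inter> E)) / real (card (S \<times> S))"

end

theory Submission
  imports Defs "HOL-Real_Asymp.Real_Asymp"
begin

text \<open>
  Suppose \<open>den S \<ge> 1 - \<delta>\<close>. Among the vertices of \<open>S\<close> with few non-neighbours in \<open>S\<close>, greedily pick
  \<open>v\<^sub>1, \<dots>, v\<^sub>m\<close>, each containing at least \<open>\<gamma>\<rho>\<close> variables not seen before; let \<open>D\<^sub>j\<close> be the variables
  that \<open>v\<^sub>j\<close> adds, and let \<open>\<sigma>\<close> follow \<open>v\<^sub>j\<close> on \<open>D\<^sub>j\<close>. Then \<open>m \<le> n / (\<gamma>\<rho>) = o(\<rho>)\<close>, and on stopping every
  remaining candidate has fewer than \<open>\<gamma>\<rho>\<close> variables outside the union of the \<open>D\<^sub>j\<close>.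

  By averaging, most vertices \<open>(T, y)\<close> of \<open>S\<close> are adjacent to all but \<open>8\<delta>m\<close> of the \<open>v\<^sub>j\<close>. There are at
  most \<open>2\<^sup>m\<close> possible sets \<open>K\<close> of neighbours among the \<open>v\<^sub>j\<close>. For fixed \<open>K\<close>, let \<open>C\<close> be the union of
  \<open>D\<^sub>j\<close> for \<open>v\<^sub>j\<close> in \<open>K\<close>: consistency forces \<open>y = \<sigma>\<close> on \<open>T \<inter> C\<close>, and the edge constraints
  forbid \<open>T\<close> to contain an endpoint of a constraint inside \<open>C\<close> that \<open>\<sigma>\<close> violates. Since \<open>\<sigma>\<close> violates
  many constraints, either there are linearly many forbidden variables or linearly many variables that
  \<open>T\<close> nearly avoids; both cost a factor \<open>exp (- \<Omega>(\<rho>))\<close> against \<open>n choose \<rho>\<close>, which beats \<open>2\<^sup>m\<close>.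
\<close>

section \<open>Weighted counting of \<open>r\<close>-subsets and of partial assignments\<close>

text \<open>When the power on the right is multiplied out, each product over an
  \<open>r\<close>-subset occurs \<open>r!\<close> times and all other terms are nonnegative. The
  induction on \<open>P\<close> splits the subsets by whether they contain the new element.\<close>

lemma fact_mult_sum_prod_subsets_le:
  fixes w :: "'a \<Rightarrow> real"
  assumes "finite P" and "\<And>p. p \<in> P \<Longrightarrow> w p \<ge> 0"
  shows "fact r * (\<Sum>X | X \<subseteq> P \<and> card X = r. \<Prod>p\<in>X. w p) \<le> (\<Sum>p\<in>P. w p) ^ r"
  using assms
proof (induction P arbitrary: r rule: finite_induct)
  case empty
  have "{X :: 'a set. X = {} \<and> card X = r} = (if r = 0 then {{}} else {})" by auto
  then show ?case by auto
next
  case (insert a P)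
  show ?case
  proof (cases r)
    case 0
    have "{X. X \<subseteq> insert a P \<and> card X = 0} = {{}}"
      using insert.hyps by (auto dest: finite_subset)
    then show ?thesis using 0 by simp
  next
    case (Suc k)
    define s where "s = (\<Sum>p\<in>P. w p)"
    define e where "e = (\<lambda>k. \<Sum>X | X \<subseteq> P \<and> card X = k. \<Prod>p\<in>X. w p)"
    have s0: "s \<ge> 0" and wa: "w a \<ge> 0"
      using insert.prems by (auto simp: s_def intro: sum_nonneg)
    have IH: "fact j * e j \<le> s ^ j" for j
      using insert.IH[of j] insert.prems by (simp add: e_def s_def)
    have split: "{X. X \<subseteq> insert a P \<and> card X = Suc k} =
        {X. X \<subseteq> P \<and> card X = Suc k} \<union> insert a ` {X. X \<subseteq> P \<and> card X = k}" (is "?L = ?R1 \<union> ?R2")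
    proof (intro equalityI subsetI)
      fix X assume X: "X \<in> ?L"
      show "X \<in> ?R1 \<union> ?R2"
      proof (cases "a \<in> X")
        case True
        then have "X = insert a (X - {a})" "X - {a} \<subseteq> P" "card (X - {a}) = k"
          using X by (auto simp: card_Diff_singleton)
        then show ?thesis by blast
      qed (use X in auto)
    next
      fix X assume "X \<in> ?R1 \<union> ?R2"
      then show "X \<in> ?L"
      proof
        assume "X \<in> ?R2"
        then obtain Y where Y: "Y \<subseteq> P" "card Y = k" "X = insert a Y" by auto
        moreover have "finite Y" "a \<notin> Y" using Y insert.hyps by (auto dest: finite_subset)
        ultimately show ?thesis by auto
      qed auto
    qed
    have fin: "finite {X. X \<subseteq> P \<and> card X = j}" for j using insert.hyps by simp
    have inj: "inj_on (insert a) {X. X \<subseteq> P \<and> card X = k}"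
    proof (rule inj_onI)
      fix X Y assume "X \<in> {X. X \<subseteq> P \<and> card X = k}" "Y \<in> {X. X \<subseteq> P \<and> card X = k}"
      then have "a \<notin> X" "a \<notin> Y" using insert.hyps by auto
      moreover assume "insert a X = insert a Y"
      ultimately show "X = Y" by (simp add: insert_ident)
    qed
    have "(\<Sum>X | X \<subseteq> insert a P \<and> card X = Suc k. \<Prod>p\<in>X. w p)
        = e (Suc k) + (\<Sum>X \<in> insert a ` {X. X \<subseteq> P \<and> card X = k}. \<Prod>p\<in>X. w p)"
      unfolding split e_def using insert.hyps fin by (intro sum.union_disjoint) auto
    also have "(\<Sum>X \<in> insert a ` {X. X \<subseteq> P \<and> card X = k}. \<Prod>p\<in>X. w p)
        = (\<Sum>X | X \<subseteq> P \<and> card X = k. w a * (\<Prod>p\<in>X. w p))"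
      unfolding sum.reindex[OF inj] using insert.hyps
      by (intro sum.cong) (auto intro!: prod.insert dest: finite_subset)
    also have "\<dots> = w a * e k" by (simp add: e_def sum_distrib_left)
    finally have "fact r * (\<Sum>X | X \<subseteq> insert a P \<and> card X = r. \<Prod>p\<in>X. w p)
        = fact (Suc k) * e (Suc k) + real (Suc k) * w a * (fact k * e k)"
      using Suc by (simp add: algebra_simps)
    also have "\<dots> \<le> s ^ Suc k + real (Suc k) * w a * s ^ k"
      using IH[of "Suc k"] IH[of k] wa by (intro add_mono mult_left_mono) auto
    \<comment> \<open>The left side consists of the first two terms of the binomial expansion; the
      inner induction multiplies by \<open>s + w a\<close> and drops a nonnegative term.\<close>
    also have "\<dots> \<le> (s + w a) ^ Suc k"
    proof (induction k)
      case (Suc k)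
      have "s ^ Suc (Suc k) + real (Suc (Suc k)) * w a * s ^ Suc k
          \<le> (s + w a) * (s ^ Suc k + real (Suc k) * w a * s ^ k)"
      proof -
        have "0 \<le> real (Suc k) * (w a * w a * s ^ k)" using s0 wa by simp
        also have "\<dots> = (s + w a) * (s ^ Suc k + real (Suc k) * w a * s ^ k)
            - (s ^ Suc (Suc k) + real (Suc (Suc k)) * w a * s ^ Suc k)"
          by (simp add: algebra_simps)
        finally show ?thesis by simp
      qed
      also have "\<dots> \<le> (s + w a) * (s + w a) ^ Suc k"
        using Suc s0 wa by (intro mult_left_mono) auto
      finally show ?case by simp
    qed simp
    also have "s + w a = (\<Sum>p\<in>insert a P. w p)" using insert.hyps by (simp add: s_def)
    finally show ?thesis by (simp only: Suc)
  qed
qed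

text \<open>A vertex is determined by the graph of its labelling, an \<open>r\<close>-subset of the
  admissible pairs \<open>P\<close>. Extensionality makes this encoding injective, so the bound for
  subsets carries over to vertices.\<close>

lemma sum_weights_partial_functions_le:
  fixes w :: "nat \<times> nat \<Rightarrow> real" and F :: "vertex set"
  assumes "finite P" and "\<And>p. p \<in> P \<Longrightarrow> w p \<ge> 0"
    and F: "\<And>T y. (T, y) \<in> F \<Longrightarrow> finite T \<and> card T = r \<and> y \<in> extensional T \<and> (\<forall>i\<in>T. (i, y i) \<in> P)"
  shows "fact r * (\<Sum>v\<in>F. \<Prod>i\<in>fst v. w (i, snd v i)) \<le> (\<Sum>p\<in>P. w p) ^ r"
proof -
  define gr where "gr = (\<lambda>v::vertex. (\<lambda>i. (i, snd v i)) ` fst v)"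
  have ext: "snd v \<in> extensional (fst v)" if "v \<in> F" for v
    using F[of "fst v" "snd v"] that by simp
  have inj: "inj_on gr F"
  proof (rule inj_onI)
    fix u v assume uv: "u \<in> F" "v \<in> F" "gr u = gr v"
    have T: "fst u = fst v" using arg_cong[OF uv(3), of "image fst"] by (simp add: gr_def image_image)
    have "snd u = snd v"
    proof (rule extensionalityI[of _ "fst u"])
      show "snd u \<in> extensional (fst u)" "snd v \<in> extensional (fst u)"
        using ext[OF uv(1)] ext[OF uv(2)] by (simp_all add: T)
      fix i assume "i \<in> fst u"
      then have "(i, snd u i) \<in> gr v" using uv(3) by (auto simp: gr_def)
      then show "snd u i = snd v i" by (auto simp: gr_def)
    qed
    with T show "u = v" by (simp add: prod_eq_iff)
  qed
  have injf: "inj_on (\<lambda>i. (i, snd v i)) (fst v)" for v :: vertex by (auto simp: inj_on_def)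
  have sub: "gr ` F \<subseteq> {X. X \<subseteq> P \<and> card X = r}"
  proof
    fix X assume "X \<in> gr ` F"
    then obtain T y where "X = gr (T, y)" "(T, y) \<in> F" by auto
    then show "X \<in> {X. X \<subseteq> P \<and> card X = r}"
      using F[of T y] by (auto simp: gr_def card_image inj_on_def)
  qed
  have "(\<Sum>v\<in>F. \<Prod>i\<in>fst v. w (i, snd v i)) = (\<Sum>v\<in>F. \<Prod>p\<in>gr v. w p)"
    by (simp add: gr_def prod.reindex[OF injf])
  also have "\<dots> = (\<Sum>X\<in>gr ` F. \<Prod>p\<in>X. w p)" by (simp add: sum.reindex[OF inj])
  also have "\<dots> \<le> (\<Sum>X | X \<subseteq> P \<and> card X = r. \<Prod>p\<in>X. w p)"
    using assms(1,2) sub by (intro sum_mono2) (auto intro!: prod_nonneg)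
  finally have "fact r * (\<Sum>v\<in>F. \<Prod>i\<in>fst v. w (i, snd v i))
      \<le> fact r * (\<Sum>X | X \<subseteq> P \<and> card X = r. \<Prod>p\<in>X. w p)"
    by (intro mult_left_mono) auto
  also have "\<dots> \<le> (\<Sum>p\<in>P. w p) ^ r"
    by (rule fact_mult_sum_prod_subsets_le) (use assms(1,2) in auto)
  finally show ?thesis .
qed

section \<open>Greedy selection of sets with many new elements\<close>

text \<open>An inclusion-maximal choice replaces the greedy process: if some \<open>v\<close> still
  had \<open>g\<close> uncovered elements, it could be added to \<open>M\<close> with these elements
  as its \<open>D v\<close>.\<close>

lemma greedy_disjoint_cover:
  fixes F :: "'v \<Rightarrow> 'a set"
  assumes "finite S" and "g \<ge> 1"
  shows "\<exists>M\<subseteq>S. \<exists>D. (\<forall>v\<in>M. D v \<subseteq> F v \<and> g \<le> card (D v)) \<and>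
    (\<forall>u\<in>M. \<forall>v\<in>M. u \<noteq> v \<longrightarrow> D u \<inter> D v = {}) \<and>
    (\<forall>v\<in>S. card (F v - (\<Union>u\<in>M. D u)) < g)"
proof -
  \<comment> \<open>The last clause is absent from the conclusion. It puts every element with an
    uncovered point outside \<open>M\<close>, so that redefining \<open>D\<close> there overwrites
    nothing.\<close>
  define ok where "ok = (\<lambda>M D. (\<forall>v\<in>M. D v \<subseteq> F v \<and> g \<le> card (D v)) \<and>
    (\<forall>u\<in>M. \<forall>v\<in>M. u \<noteq> v \<longrightarrow> D u \<inter> D v = {}) \<and> (\<forall>v\<in>M. F v \<subseteq> (\<Union>u\<in>M. D u)))"
  define Ok where "Ok = {M \<in> Pow S. \<exists>D. ok M D}"
  have "finite Ok" "{} \<in> Ok" using assms by (auto simp: Ok_def ok_def)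
  then have "\<exists>M\<in>Ok. \<forall>M'\<in>Ok. M \<subseteq> M' \<longrightarrow> M = M'"
    by (intro finite_has_maximal) auto
  then obtain M where M: "M \<in> Ok" and max: "\<And>M'. M' \<in> Ok \<Longrightarrow> M \<subseteq> M' \<Longrightarrow> M = M'"
    by blast
  obtain D where D: "ok M D" using M by (auto simp: Ok_def)
  have "card (F v - (\<Union>u\<in>M. D u)) < g" if v: "v \<in> S" for v
  proof (rule ccontr)
    assume "\<not> ?thesis"
    then have ge: "g \<le> card (F v - (\<Union>u\<in>M. D u))" by simp
    then have "F v - (\<Union>u\<in>M. D u) \<noteq> {}" using assms(2) by (metis card.empty not_one_le_zero le_trans)
    then have nM: "v \<notin> M" using D by (auto simp: ok_def)
    define D' where "D' = D(v := F v - (\<Union>u\<in>M. D u))"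
    have D': "D' u = D u" if "u \<in> M" for u using that nM by (auto simp: D'_def)
    have Dv: "D' v = F v - (\<Union>u\<in>M. D u)" by (simp add: D'_def)
    have "ok (insert v M) D'"
      using D ge unfolding ok_def by (auto simp: D' Dv cong: ball_cong)
    then have "insert v M \<in> Ok" using M v by (auto simp: Ok_def)
    from max[OF this] nM show False by auto
  qed
  moreover have "M \<subseteq> S" using M by (simp add: Ok_def)
  ultimately show ?thesis using D unfolding ok_def by (intro exI[of _ M] exI[of _ D] conjI) blast+
qed

section \<open>Counting vertices with forced, free and rare variables\<close>

text \<open>Labels on \<open>C\<close> are forced, \<open>B\<close> is forbidden, \<open>U\<close>
  is free, and the remaining variables are rare. The bound is useful when the base of the
  \<open>r\<close>-th power is below \<open>n\<close>; a rare variable would contribute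
  \<open>q\<close> to it, which is lowered to 1/2 at the price of one factor \<open>2 * q\<close>
  per use.\<close>

lemma card_restricted_vertices_le:
  fixes F :: "vertex set" and \<sigma> :: "nat \<Rightarrow> nat"
  assumes "finite A" and q: "card A = q" "q \<ge> 1"
    and sets: "C \<subseteq> {0..<n}" "U \<subseteq> {0..<n}" "C \<inter> U = {}"
    and F: "\<And>T y. (T, y) \<in> F \<Longrightarrow> T \<subseteq> {0..<n} \<and> card T = r \<and> y \<in> PiE T (\<lambda>_. A) \<and>
      (\<forall>i\<in>T \<inter> C. y i = \<sigma> i) \<and> T \<inter> B = {} \<and> card (T - (C \<union> U)) \<le> h"
  shows "fact r * real (card F)
    \<le> (2 * real q) ^ h * (real (card (C - B)) + real q * real (card U) + real (card ({0..<n} - (C \<union> U))) / 2) ^ r"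
proof -
  define R where "R = {0..<n} - (C \<union> U)"
  define x where "x = 1 / (2 * real q)"
  \<comment> \<open>Each variable of \<open>T\<close> in \<open>R\<close> is discounted by \<open>x\<close>. At most \<open>h\<close> of them occur in a given \<open>T\<close>,
    while the discount cuts the total weight of the \<open>q\<close> labels on such a variable to \<open>1/2\<close>.\<close>
  define w where "w = (\<lambda>p::nat \<times> nat. if fst p \<in> R then x else 1)"
  define P1 where "P1 = (\<lambda>i. (i, \<sigma> i)) ` (C - B)"
  have fin: "finite C" "finite U" "finite R" using sets(1,2) by (auto simp: R_def intro: finite_subset)
  have x: "0 < x" "x \<le> 1" using q by (auto simp: x_def)
  have fP: "finite P1" "finite (U \<times> A)" "finite (R \<times> A)" using fin assms(1) by (auto simp: P1_def)
  have inj: "inj_on (\<lambda>i. (i, \<sigma> i)) (C - B)" by (auto simp: inj_on_def)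
  have sum: "(\<Sum>p\<in>P1 \<union> U \<times> A \<union> R \<times> A. w p)
      = real (card (C - B)) + real q * real (card U) + real (card R) / 2"
  proof -
    have "(\<Sum>p\<in>P1 \<union> U \<times> A \<union> R \<times> A. w p)
        = (\<Sum>p\<in>P1. w p) + (\<Sum>p\<in>U \<times> A. w p) + (\<Sum>p\<in>R \<times> A. w p)"
    proof -
      have "P1 \<inter> U \<times> A = {}" "(P1 \<union> U \<times> A) \<inter> R \<times> A = {}" using sets by (auto simp: P1_def R_def)
      then show ?thesis using fP by (simp add: sum.union_disjoint)
    qed
    also have "(\<Sum>p\<in>P1. w p) = (\<Sum>p\<in>P1. 1)"
      by (rule sum.cong) (auto simp: P1_def w_def R_def)
    also have "\<dots> = real (card (C - B))" by (simp add: P1_def card_image[OF inj])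
    also have "(\<Sum>p\<in>U \<times> A. w p) = (\<Sum>p\<in>U \<times> A. 1)"
      by (rule sum.cong) (auto simp: w_def R_def)
    also have "\<dots> = real q * real (card U)" by (simp add: q card_cartesian_product mult.commute)
    also have "(\<Sum>p\<in>R \<times> A. w p) = (\<Sum>p\<in>R \<times> A. x)"
      by (rule sum.cong) (auto simp: w_def)
    also have "\<dots> = real (card R) / 2" using q by (simp add: card_cartesian_product x_def)
    finally show ?thesis .
  qed
  have main: "fact r * (\<Sum>v\<in>F. \<Prod>i\<in>fst v. w (i, snd v i)) \<le> (\<Sum>p\<in>P1 \<union> U \<times> A \<union> R \<times> A. w p) ^ r"
  proof (rule sum_weights_partial_functions_le)
    show "finite (P1 \<union> U \<times> A \<union> R \<times> A)" using fP by simp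
    show "w p \<ge> 0" for p using x by (simp add: w_def)
    fix T y assume Ty: "(T, y) \<in> F"
    note f = F[OF Ty]
    have "(i, y i) \<in> P1 \<union> U \<times> A \<union> R \<times> A" if i: "i \<in> T" for i
    proof -
      have "y i \<in> A" "i \<in> {0..<n}" "i \<notin> B" "i \<in> C \<Longrightarrow> y i = \<sigma> i" using f i by auto
      then show ?thesis by (cases "i \<in> C"; cases "i \<in> U") (auto simp: P1_def R_def)
    qed
    then show "finite T \<and> card T = r \<and> y \<in> extensional T \<and> (\<forall>i\<in>T. (i, y i) \<in> P1 \<union> U \<times> A \<union> R \<times> A)"
      using f finite_subset[of T "{0..<n}"] by (auto simp: PiE_def)
  qed
  have "x ^ h \<le> (\<Prod>i\<in>fst v. w (i, snd v i))" if "v \<in> F" for v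
  proof -
    have f: "fst v \<subseteq> {0..<n}" "card (fst v - (C \<union> U)) \<le> h" using F[of "fst v" "snd v"] that by auto
    have fv: "finite (fst v)" using f finite_subset by auto
    have "(\<Prod>i\<in>fst v. w (i, snd v i)) = x ^ card (fst v \<inter> R)"
      using fv by (simp add: w_def prod.If_cases)
    also have "fst v \<inter> R = fst v - (C \<union> U)" using f by (auto simp: R_def)
    finally show ?thesis using f x by (simp add: power_decreasing)
  qed
  then have "real (card F) * x ^ h \<le> (\<Sum>v\<in>F. \<Prod>i\<in>fst v. w (i, snd v i))"
    by (rule sum_bounded_below)
  then have "fact r * (real (card F) * x ^ h) \<le> fact r * (\<Sum>v\<in>F. \<Prod>i\<in>fst v. w (i, snd v i))"
    by (intro mult_left_mono) auto
  also note main[unfolded sum]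
  finally have "fact r * real (card F) * x ^ h
      \<le> (real (card (C - B)) + real q * real (card U) + real (card R) / 2) ^ r"
    by (simp only: mult.assoc)
  then have "(2 * real q) ^ h * (fact r * real (card F) * x ^ h)
      \<le> (2 * real q) ^ h * (real (card (C - B)) + real q * real (card U) + real (card R) / 2) ^ r"
    by (intro mult_left_mono) auto
  moreover have "(2 * real q) ^ h * (fact r * real (card F) * x ^ h) = fact r * real (card F)"
    using q by (simp add: x_def power_divide)
  ultimately show ?thesis by (simp only: R_def)
qed

section \<open>Incidence counts in the constraint graph\<close>

text \<open>\<open>Ec\<close> lists each constraint in only one orientation, so sending a neighbour
  of \<open>i\<close> to the edge joining it to \<open>i\<close> reaches every incident edge exactly
  once.\<close>

lemma card_incident_edges:
  assumes "csp_wf n Ec" and "constraint_graph_regular n Ec d" and "i < n"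
  shows "card {e \<in> Ec. fst e = i \<or> snd e = i} = d"
proof -
  have wf: "(a, b) \<in> Ec \<Longrightarrow> a \<noteq> b \<and> (b, a) \<notin> Ec" for a b using assms(1) by (auto simp: csp_wf_def)
  define f where "f = (\<lambda>j. if (i, j) \<in> Ec then (i, j) else (j, i))"
  have inj: "inj_on f {j. (i, j) \<in> Ec \<or> (j, i) \<in> Ec}"
    by (rule inj_onI) (auto simp: f_def split: if_splits)
  have "{e \<in> Ec. fst e = i \<or> snd e = i} \<subseteq> f ` {j. (i, j) \<in> Ec \<or> (j, i) \<in> Ec}"
  proof
    fix e assume e: "e \<in> {e \<in> Ec. fst e = i \<or> snd e = i}"
    obtain a b where [simp]: "e = (a, b)" by (cases e)
    from e consider "a = i" "(i, b) \<in> Ec" | "b = i" "(a, i) \<in> Ec" "(i, a) \<notin> Ec" using wf by auto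
    then show "e \<in> f ` {j. (i, j) \<in> Ec \<or> (j, i) \<in> Ec}"
    proof cases
      case 1
      then have "e = f b" by (simp add: f_def)
      then show ?thesis using 1 by blast
    next
      case 2
      then have "e = f a" by (simp add: f_def)
      then show ?thesis using 2 by blast
    qed
  qed
  moreover have "f ` {j. (i, j) \<in> Ec \<or> (j, i) \<in> Ec} \<subseteq> {e \<in> Ec. fst e = i \<or> snd e = i}"
    by (auto simp: f_def)
  ultimately have "{e \<in> Ec. fst e = i \<or> snd e = i} = f ` {j. (i, j) \<in> Ec \<or> (j, i) \<in> Ec}" by simp
  then show ?thesis using assms(2,3) by (simp add: card_image[OF inj] constraint_graph_regular_def)
qed

lemma double_card_edges:
  assumes "csp_wf n Ec" and "constraint_graph_regular n Ec d"
  shows "2 * card Ec = n * d"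
proof -
  have Ec: "Ec \<subseteq> {0..<n} \<times> {0..<n}" using assms(1) by (simp add: csp_wf_def)
  then have fin: "finite Ec" using finite_subset by blast
  have "n * d = (\<Sum>i\<in>{0..<n}. card {e \<in> Ec. fst e = i \<or> snd e = i})"
    using card_incident_edges[OF assms] by simp
  also have "\<dots> = (\<Sum>e\<in>Ec. card {i \<in> {0..<n}. fst e = i \<or> snd e = i})"
    using fin by (intro sum_multicount_gen) auto
  also have "\<dots> = (\<Sum>e\<in>Ec. 2)"
  proof (rule sum.cong)
    fix e assume "e \<in> Ec"
    then have "{i \<in> {0..<n}. fst e = i \<or> snd e = i} = {fst e, snd e}" "fst e \<noteq> snd e"
      using Ec assms(1) by (auto simp: csp_wf_def)
    then show "card {i \<in> {0..<n}. fst e = i \<or> snd e = i} = 2" by simp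
  qed simp
  finally show ?thesis by simp
qed

lemma card_edges_touching_le:
  assumes "csp_wf n Ec" and "constraint_graph_regular n Ec d" and X: "X \<subseteq> {0..<n}"
    and "E' \<subseteq> Ec" and "\<And>e. e \<in> E' \<Longrightarrow> fst e \<in> X \<or> snd e \<in> X"
  shows "card E' \<le> d * card X"
proof -
  have "finite Ec" using assms(1) finite_subset by (auto simp: csp_wf_def)
  have "finite X" using X finite_subset by blast
  have "E' \<subseteq> (\<Union>i\<in>X. {e \<in> Ec. fst e = i \<or> snd e = i})" using assms(4,5) by blast
  then have "card E' \<le> card (\<Union>i\<in>X. {e \<in> Ec. fst e = i \<or> snd e = i})"
    using \<open>finite Ec\<close> \<open>finite X\<close> by (intro card_mono) auto
  also have "\<dots> \<le> (\<Sum>i\<in>X. card {e \<in> Ec. fst e = i \<or> snd e = i})"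
    using \<open>finite X\<close> by (rule card_UN_le)
  also have "\<dots> = (\<Sum>i\<in>X. d)"
    using X card_incident_edges[OF assms(1,2)] by (intro sum.cong) auto
  finally show ?thesis by (simp add: mult.commute)
qed

section \<open>Averaging, finiteness and the value gap\<close>

lemma card_markov:
  fixes f :: "'a \<Rightarrow> real"
  assumes "finite S" and "\<And>v. v \<in> S \<Longrightarrow> f v \<ge> 0" and "t > 0" and "(\<Sum>v\<in>S. f v) \<le> t * c"
  shows "real (card {v \<in> S. f v > t}) \<le> c"
proof -
  have "real (card {v \<in> S. f v > t}) * t \<le> (\<Sum>v | v \<in> S \<and> f v > t. f v)"
    by (rule sum_bounded_below) auto
  also have "\<dots> \<le> (\<Sum>v\<in>S. f v)" using assms by (intro sum_mono2) auto
  finally have "t * real (card {v \<in> S. f v > t}) \<le> t * c" using assms(4) by (simp add: mult.commute)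
  then show ?thesis using assms(3) by simp
qed

lemma finite_G_V: "finite A \<Longrightarrow> finite (G_V n A)"
proof -
  assume A: "finite A"
  have "G_V n A \<subseteq> (\<Union>T\<in>Pow {0..<n}. {T} \<times> PiE T (\<lambda>_. A))" by (auto simp: G_V_def)
  moreover have "finite (\<Union>T\<in>Pow {0..<n}. {T} \<times> PiE T (\<lambda>_. A))"
    using A by (intro finite_UN_I finite_cartesian_product finite_PiE) (auto intro: finite_subset)
  ultimately show ?thesis by (rule finite_subset)
qed

lemma many_violated_edges:
  assumes "finite A" and "csp_wf n Ec" and "constraint_graph_regular n Ec d"
    and "n > 0" and "d > 0" and opt: "csp_OPT n A Ec psi < 1 - \<eta>"
    and \<sigma>: "\<And>i. i < n \<Longrightarrow> \<sigma> i \<in> A"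
  shows "\<eta> * (real n * real d / 2) < real (card {(i, j) \<in> Ec. \<not> psi i j (\<sigma> i) (\<sigma> j)})"
proof -
  \<comment> \<open>\<open>assignments\<close> contains only extensional functions, whereas
    \<open>\<sigma>\<close> is total; restricting it changes no label on an endpoint of a
    constraint.\<close>
  define s where "s = restrict \<sigma> {0..<n}"
  have Ec: "Ec \<subseteq> {0..<n} \<times> {0..<n}" using assms(2) by (simp add: csp_wf_def)
  then have fin: "finite Ec" using finite_subset by blast
  have Ecc: "real (card Ec) = real n * real d / 2"
    using arg_cong[OF double_card_edges[OF assms(2,3)], of real] by simp
  have pos: "real (card Ec) > 0" using assms(4,5) unfolding Ecc by simp
  have "finite (assignments n A)" unfolding assignments_def using assms(1) by (intro finite_PiE) auto
  moreover have "s \<in> assignments n A" using \<sigma> by (auto simp: s_def assignments_def)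
  ultimately have "csp_value Ec psi s \<le> csp_OPT n A Ec psi" by (simp add: csp_OPT_def)
  then have "csp_value Ec psi s < 1 - \<eta>" using opt by simp
  then have lt: "real (card {(i, j) \<in> Ec. psi i j (s i) (s j)}) < (1 - \<eta>) * real (card Ec)"
    using pos by (simp add: csp_value_def divide_less_eq)
  have eq: "{(i, j) \<in> Ec. psi i j (s i) (s j)} = {(i, j) \<in> Ec. psi i j (\<sigma> i) (\<sigma> j)}"
    using Ec by (auto simp: s_def)
  have "card Ec = card ({(i, j) \<in> Ec. psi i j (\<sigma> i) (\<sigma> j)} \<union> {(i, j) \<in> Ec. \<not> psi i j (\<sigma> i) (\<sigma> j)})"
    by (rule arg_cong[of _ _ card]) auto
  also have "\<dots> = card {(i, j) \<in> Ec. psi i j (\<sigma> i) (\<sigma> j)} + card {(i, j) \<in> Ec. \<not> psi i j (\<sigma> i) (\<sigma> j)}"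
    using fin by (intro card_Un_disjoint) (auto intro: finite_subset)
  finally show ?thesis using lt unfolding eq Ecc[symmetric] by (simp add: algebra_simps)
qed

section \<open>Upper bound on the size of a dense vertex set\<close>

text \<open>The factors in order: 4 because a quarter of \<open>S\<close> is retained, the number of
  neighbourhood classes, the price of the rare variables, and a base that gains
  \<open>exp (- \<eta> / 8)\<close> over \<open>n\<close>.\<close>

lemma card_dense_set_le:
  fixes \<eta> \<gamma> \<delta> :: real
  assumes A: "finite A" "card A = q" "q \<ge> 1" and wf: "csp_wf n Ec" and reg: "constraint_graph_regular n Ec d"
    and n: "n > 0" and d: "d > 0" and opt: "csp_OPT n A Ec psi < 1 - \<eta>"
    and \<gamma>: "\<gamma> > 0" and \<eta>: "\<eta> > 0" and r: "rho n > 0" and \<delta>: "\<delta> = \<eta> * \<gamma> / (64 * real q)"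
    and S: "S \<subseteq> G_V n A" and den: "den S (G_E n A Ec psi) \<ge> 1 - \<delta>" and S0: "card S > 0"
  shows "fact (rho n) * real (card S) \<le> 4 * 2 powr (real n / (\<gamma> * real (rho n)))
    * (2 * real q) powr (\<gamma> * real (rho n)) * (real n * exp (- \<eta> / 8)) ^ rho n"
proof -
  define r where "r = rho n"
  define E where "E = G_E n A Ec psi"
  define g where "g = nat \<lceil>\<gamma> * real r\<rceil>"
  have finS: "finite S" using S finite_G_V[OF A(1)] finite_subset by blast
  have \<delta>0: "\<delta> > 0" using \<delta> \<eta> \<gamma> A by simp
  have g1: "g \<ge> 1" and g: "\<gamma> * real r \<le> real g" "real g < \<gamma> * real r + 1"
  proof -
    have p: "\<gamma> * real r > 0" using \<gamma> r by (simp add: r_def)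
    then show "\<gamma> * real r \<le> real g" "real g < \<gamma> * real r + 1" unfolding g_def by linarith+
    with p show "g \<ge> 1" by (cases g) auto
  qed
  have vert: "fst v \<subseteq> {0..<n}" "card (fst v) = r" "snd v \<in> PiE (fst v) (\<lambda>_. A)" "finite (fst v)" if "v \<in> S" for v
  proof -
    have "(fst v, snd v) \<in> G_V n A" using that S by auto
    then show "fst v \<subseteq> {0..<n}" "card (fst v) = r" "snd v \<in> PiE (fst v) (\<lambda>_. A)"
      unfolding G_V_def r_def by blast+
    then show "finite (fst v)" using finite_subset by blast
  qed

  define bad where "bad = (\<lambda>v. real (card {w \<in> S. (v, w) \<notin> E}))"
  \<comment> \<open>The sum counts the non-edges in \<open>S \<times> S\<close> by their first
    coordinate.\<close>
  have "(\<Sum>v\<in>S. bad v) \<le> \<delta> * real (card S) ^ 2"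
  proof -
    have "(\<Sum>v\<in>S. card {w \<in> S. (v, w) \<notin> E}) = card (SIGMA v:S. {w \<in> S. (v, w) \<notin> E})"
      using finS by simp
    also have "(SIGMA v:S. {w \<in> S. (v, w) \<notin> E}) = S \<times> S - (S \<times> S) \<inter> E" by auto
    also have "card (S \<times> S - (S \<times> S) \<inter> E) = card (S \<times> S) - card ((S \<times> S) \<inter> E)"
      using finS by (intro card_Diff_subset) auto
    finally have eq: "(\<Sum>v\<in>S. card {w \<in> S. (v, w) \<notin> E}) = card (S \<times> S) - card ((S \<times> S) \<inter> E)" .
    have "card ((S \<times> S) \<inter> E) \<le> card (S \<times> S)" using finS by (intro card_mono) auto
    then have "(\<Sum>v\<in>S. bad v) = real (card (S \<times> S)) - real (card ((S \<times> S) \<inter> E))"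
      unfolding bad_def of_nat_sum[symmetric] eq by (rule of_nat_diff)
    moreover have "(1 - \<delta>) * real (card (S \<times> S)) \<le> real (card ((S \<times> S) \<inter> E))"
      using den S0 finS by (simp add: den_def E_def[symmetric] card_cartesian_product pos_le_divide_eq)
    ultimately show ?thesis by (simp add: card_cartesian_product algebra_simps power2_eq_square)
  qed
  then have "(\<Sum>v\<in>S. bad v) \<le> (2 * \<delta> * real (card S)) * (real (card S) / 2)"
    by (simp add: power2_eq_square)
  then have half: "real (card {v \<in> S. bad v > 2 * \<delta> * real (card S)}) \<le> real (card S) / 2"
    using finS S0 \<delta>0 by (intro card_markov) (auto simp: bad_def)

  define S1 where "S1 = {v \<in> S. bad v \<le> 2 * \<delta> * real (card S)}"
  have S1: "S1 \<subseteq> S" "finite S1" using finS by (auto simp: S1_def)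
  \<comment> \<open>Selecting from \<open>S1\<close> rather than from \<open>S\<close> ensures that
    every member of \<open>M\<close> has few non-neighbours, which bounds the sum of
    \<open>miss\<close> below.\<close>
  obtain M D where M: "M \<subseteq> S1"
    and D_bounds: "\<forall>v\<in>M. D v \<subseteq> fst v \<and> g \<le> card (D v)"
    and D_disj: "\<forall>u\<in>M. \<forall>v\<in>M. u \<noteq> v \<longrightarrow> D u \<inter> D v = {}"
    and D_cover: "\<forall>v\<in>S1. card (fst v - (\<Union>u\<in>M. D u)) < g"
    using greedy_disjoint_cover[OF S1(2) g1, of fst] by (elim exE conjE) (rule that)
  have D: "D v \<subseteq> fst v" "g \<le> card (D v)" if "v \<in> M" for v
    using D_bounds that by simp_all
  have disj: "D u \<inter> D v = {}" if "u \<in> M" "v \<in> M" "u \<noteq> v" for u v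
    using D_disj that by simp
  have cover: "card (fst v - (\<Union>u\<in>M. D u)) < g" if "v \<in> S1" for v
    using D_cover that by simp
  have finM: "finite M" using M S1 finite_subset by blast
  have MS: "v \<in> S" if "v \<in> M" for v using that M S1 by auto
  have Dv: "D v \<subseteq> {0..<n}" "finite (D v)" "card (D v) \<le> r" if "v \<in> M" for v
    using D(1)[OF that] vert[OF MS[OF that]] card_mono[of "fst v" "D v"] by (auto intro: finite_subset)

  have Mg: "real (card M) * (\<gamma> * real r) \<le> real n"
  proof -
    have "card M * g = (\<Sum>v\<in>M. g)" by simp
    also have "\<dots> \<le> (\<Sum>v\<in>M. card (D v))" using D(2) by (intro sum_mono)
    also have "\<dots> = card (\<Union>v\<in>M. D v)"
      using finM Dv(2) disj by (intro card_UN_disjoint[symmetric]) auto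
    also have "\<dots> \<le> card {0..<n}" using Dv(1) by (intro card_mono) auto
    finally have "real (card M) * real g \<le> real n" by (simp flip: of_nat_mult)
    moreover have "real (card M) * (\<gamma> * real r) \<le> real (card M) * real g"
      using g by (intro mult_left_mono) auto
    ultimately show ?thesis by linarith
  qed

  define N where "N = (\<lambda>w. {v \<in> M. (v, w) \<in> E})"
  define miss where "miss = (\<lambda>w. real (card {v \<in> M. (v, w) \<notin> E}))"
  have "(\<Sum>w\<in>S. miss w) = (\<Sum>v\<in>M. bad v)"
    unfolding miss_def bad_def of_nat_sum[symmetric]
    using finS finM by (subst sum_multicount_gen[of M S "\<lambda>v w. (v, w) \<notin> E", symmetric]) auto
  also have "\<dots> \<le> real (card M) * (2 * \<delta> * real (card S))"
    using M by (intro sum_bounded_above) (auto simp: S1_def)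
  finally have miss_sum: "(\<Sum>w\<in>S. miss w) \<le> (8 * \<delta> * real (card M)) * (real (card S) / 4)"
    by (simp add: mult_ac)
  have quarter: "real (card {w \<in> S. miss w > 8 * \<delta> * real (card M)}) \<le> real (card S) / 4"
  proof (cases "M = {}")
    case True
    then show ?thesis by (simp add: miss_def)
  next
    case False
    then have "card M > 0" using finM by (simp add: card_gt_0_iff)
    then show ?thesis using finS \<delta>0 miss_sum by (intro card_markov) (auto simp: miss_def)
  qed

  define S2 where "S2 = {w \<in> S1. miss w \<le> 8 * \<delta> * real (card M)}"
  have S2_large: "real (card S) / 4 \<le> real (card S2)"
  proof -
    let ?X = "{v \<in> S. bad v > 2 * \<delta> * real (card S)}"
    let ?Y = "{w \<in> S. miss w > 8 * \<delta> * real (card M)}"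
    have "S \<subseteq> S2 \<union> ?X \<union> ?Y" by (auto simp: S2_def S1_def not_less)
    then have "card S \<le> card (S2 \<union> ?X \<union> ?Y)"
      using finS S1 by (intro card_mono) (auto simp: S2_def)
    also have "\<dots> \<le> card S2 + card ?X + card ?Y"
      using card_Un_le[of "S2 \<union> ?X" ?Y] card_Un_le[of S2 ?X] by linarith
    finally have "real (card S) \<le> real (card S2) + real (card ?X) + real (card ?Y)" by linarith
    with half quarter show ?thesis by linarith
  qed

  \<comment> \<open>The default \<open>a0\<close> labels the variables that no \<open>D v\<close>
    contains, so that \<open>\<sigma>\<close> is a full assignment to which the gap in the optimum
    applies. Disjointness makes the choice of \<open>v\<close> unique elsewhere.\<close>
  obtain a0 where a0: "a0 \<in> A" using A by fastforce
  define \<sigma> where "\<sigma> = (\<lambda>i. if \<exists>v\<in>M. i \<in> D v then snd (SOME v. v \<in> M \<and> i \<in> D v) i else a0)"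
  have \<sigma>: "\<sigma> i = snd v i" if "v \<in> M" "i \<in> D v" for v i
  proof -
    have "(SOME v. v \<in> M \<and> i \<in> D v) = v"
    proof (rule some_equality)
      fix u assume "u \<in> M \<and> i \<in> D u"
      then show "u = v" using that disj by blast
    qed (use that in simp)
    then show ?thesis using that by (auto simp: \<sigma>_def)
  qed
  have \<sigma>A: "\<sigma> i \<in> A" for i
  proof (cases "\<exists>v\<in>M. i \<in> D v")
    case True
    then obtain v where v: "v \<in> M" "i \<in> D v" by auto
    then show ?thesis using \<sigma>[OF v] vert[OF MS[OF v(1)]] D(1)[OF v(1)] by auto
  qed (use a0 in \<open>simp add: \<sigma>_def\<close>)

  define X where "X = (2 * real q) powr (\<gamma> * real r) * (real n * exp (- \<eta> / 8)) ^ r"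
  have X0: "X \<ge> 0" by (simp add: X_def)
  have per_class: "fact r * real (card {w \<in> S2. N w = K}) \<le> X" if K: "K \<subseteq> M" for K
  proof (cases "{w \<in> S2. N w = K} = {}")
    case True
    show ?thesis unfolding True using X0 by simp
  next
    case False
    \<comment> \<open>A member of the class certifies that \<open>K\<close> omits few elements of
      \<open>M\<close>; this is what makes \<open>U\<close> small.\<close>
    then obtain w0 where w0: "w0 \<in> S2" "N w0 = K" by auto
    define C where "C = (\<Union>v\<in>K. D v)"
    define U where "U = (\<Union>v\<in>M - K. D v)"
    define viol where "viol = {(i, j) \<in> Ec. \<not> psi i j (\<sigma> i) (\<sigma> j)}"
    define B where "B = {b \<in> C. \<exists>e\<in>viol. fst e \<in> C \<and> snd e \<in> C \<and> (fst e = b \<or> snd e = b)}"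
    have sub: "C \<subseteq> {0..<n}" "U \<subseteq> {0..<n}" using K Dv by (auto simp: C_def U_def)
    have "D u \<inter> D v = {}" if "u \<in> K" "v \<in> M - K" for u v using disj[of u v] K that by auto
    then have CU: "C \<inter> U = {}" "C \<union> U = (\<Union>v\<in>M. D v)" using K unfolding C_def U_def by blast+
    have fin: "finite C" "finite U" using sub by (auto intro: finite_subset)
    have BC: "B \<subseteq> C" by (auto simp: B_def)

    \<comment> \<open>The value of \<open>\<delta>\<close> is chosen for this estimate: even with
      all \<open>q\<close> labels allowed, the variables in \<open>U\<close> contribute at most
      \<open>\<eta> * n / 8\<close>.\<close>
    have "real (card U) \<le> real r * real (card (M - K))"
    proof -
      have "card U \<le> (\<Sum>v\<in>M - K. card (D v))" unfolding U_def using finM by (intro card_UN_le) auto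
      also have "\<dots> \<le> (\<Sum>v\<in>M - K. r)" using Dv by (intro sum_mono) auto
      also have "\<dots> = r * card (M - K)" by simp
      finally show ?thesis by (simp flip: of_nat_mult)
    qed
    also have "M - K = {v \<in> M. (v, w0) \<notin> E}" using w0 by (auto simp: N_def)
    also have "real r * real (card {v \<in> M. (v, w0) \<notin> E}) \<le> real r * (8 * \<delta> * real (card M))"
      using w0 by (intro mult_left_mono) (auto simp: S2_def miss_def)
    also have "\<dots> = (8 * \<delta> / \<gamma>) * (real (card M) * (\<gamma> * real r))" using \<gamma> by simp
    also have "\<dots> \<le> (8 * \<delta> / \<gamma>) * real n" using Mg \<gamma> \<delta>0 by (intro mult_left_mono) auto
    also have "8 * \<delta> / \<gamma> = \<eta> / (8 * real q)" using \<gamma> by (simp add: \<delta>)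
    finally have "real q * real (card U) \<le> real q * (\<eta> / (8 * real q) * real n)"
      by (intro mult_left_mono) auto
    then have U: "real q * real (card U) \<le> \<eta> * real n / 8" using A by simp

    \<comment> \<open>A violated constraint either leaves \<open>C\<close> or has both ends in
      \<open>B\<close>. As each variable meets only \<open>d\<close> constraints, the complement of
      \<open>C\<close> and \<open>B\<close> together have at least \<open>\<eta> * n / 2\<close>
      elements.\<close>
    have "card viol \<le> d * card (({0..<n} - C) \<union> B)"
    proof (rule card_edges_touching_le[OF wf reg])
      fix e assume e: "e \<in> viol"
      then have "e \<in> {0..<n} \<times> {0..<n}" using wf by (auto simp: viol_def csp_wf_def)
      then show "fst e \<in> ({0..<n} - C) \<union> B \<or> snd e \<in> ({0..<n} - C) \<union> B"
        using e by (auto simp: B_def)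
    qed (use BC sub in \<open>auto simp: viol_def\<close>)
    also have "\<dots> \<le> d * (card ({0..<n} - C) + card B)" by (intro mult_left_mono card_Un_le) auto
    finally have "real (card viol) \<le> real d * (real (card ({0..<n} - C)) + real (card B))"
      by (simp flip: of_nat_mult of_nat_add)
    moreover have "\<eta> * (real n * real d / 2) < real (card viol)"
      unfolding viol_def by (rule many_violated_edges[OF A(1) wf reg n d opt]) (rule \<sigma>A)
    ultimately have "real d * (\<eta> * real n / 2) \<le> real d * (real (card ({0..<n} - C)) + real (card B))"
      by (simp add: algebra_simps)
    then have V: "\<eta> * real n / 2 \<le> real (card ({0..<n} - C)) + real (card B)" using d by simp

    let ?R = "{0..<n} - (C \<union> U)"
    have cC: "card C = card (C - B) + card B"
      using card_Diff_subset[of B C] card_mono[of C B] fin BC finite_subset[OF BC] by simp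
    have "card ({0..<n} - C) = card (U \<union> ?R)" using sub CU by (intro arg_cong[of _ _ card]) auto
    also have "\<dots> = card U + card ?R" using fin by (intro card_Un_disjoint) auto
    finally have cR: "card ({0..<n} - C) = card U + card ?R" .
    have "card ({0..<n} - C) = n - card C" "card C \<le> n"
      using card_Diff_subset[OF fin(1) sub(1)] card_mono[OF _ sub(1)] by auto
    then have cn: "real n = real (card C) + real (card ({0..<n} - C))" by simp

    \<comment> \<open>The cover leaves strictly fewer than \<open>g\<close> variables, so
      \<open>h = g - 1\<close>; this stays below \<open>\<gamma> * r\<close> although
      \<open>g\<close> is rounded up.\<close>
    have "fact r * real (card {w \<in> S2. N w = K}) \<le> (2 * real q) ^ (g - 1)
        * (real (card (C - B)) + real q * real (card U) + real (card ?R) / 2) ^ r"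
    proof (rule card_restricted_vertices_le[where \<sigma> = \<sigma>, OF A sub CU(1)])
      fix T y assume Ty: "(T, y) \<in> {w \<in> S2. N w = K}"
      then have TS: "(T, y) \<in> S1" "(T, y) \<in> S" using S1 by (auto simp: S2_def)
      have adj: "(v, (T, y)) \<in> E" if "v \<in> K" for v using Ty that by (auto simp: N_def)
      have agree: "y i = \<sigma> i" if i: "i \<in> T" "i \<in> C" for i
      proof -
        obtain v where v: "v \<in> K" "i \<in> D v" using i(2) unfolding C_def by blast
        then have "i \<in> fst v" using D(1)[of v] K by blast
        then have "snd v i = y i" using adj[OF v(1)] i by (auto simp: E_def G_E_def)
        then show ?thesis using \<sigma>[of v i] v K by auto
      qed
      \<comment> \<open>The end in \<open>T\<close> has label \<open>\<sigma>\<close> by agreement,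
        and the other end takes its label from a neighbour in \<open>K\<close>, so adjacency
        enforces the constraint. The two orientations in \<open>G_E\<close> serve the two
        cases.\<close>
      have sat: "psi i j (\<sigma> i) (\<sigma> j)"
        if ij: "(i, j) \<in> Ec" "i \<in> C" "j \<in> C" and T: "i \<in> T \<or> j \<in> T" for i j
        using T
      proof
        assume "i \<in> T"
        obtain v where v: "v \<in> K" "j \<in> D v" using ij(3) unfolding C_def by blast
        then have "j \<in> fst v" using D(1)[of v] K by blast
        then have "psi i j (y i) (snd v j)" using adj[OF v(1)] \<open>i \<in> T\<close> ij(1) by (auto simp: E_def G_E_def)
        then show ?thesis using \<sigma>[of v j] v K agree[OF \<open>i \<in> T\<close> ij(2)] by auto
      next
        assume "j \<in> T"
        obtain v where v: "v \<in> K" "i \<in> D v" using ij(2) unfolding C_def by blast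
        then have "i \<in> fst v" using D(1)[of v] K by blast
        then have "psi i j (snd v i) (y j)" using adj[OF v(1)] \<open>j \<in> T\<close> ij(1) by (auto simp: E_def G_E_def)
        then show ?thesis using \<sigma>[of v i] v K agree[OF \<open>j \<in> T\<close> ij(3)] by auto
      qed
      have "T \<inter> B = {}" using sat by (fastforce simp: B_def viol_def)
      moreover have "card (T - (C \<union> U)) \<le> g - 1" using cover[OF TS(1)] CU(2) by simp
      ultimately show "T \<subseteq> {0..<n} \<and> card T = r \<and> y \<in> PiE T (\<lambda>_. A) \<and>
          (\<forall>i\<in>T \<inter> C. y i = \<sigma> i) \<and> T \<inter> B = {} \<and> card (T - (C \<union> U)) \<le> g - 1"
        using vert[OF TS(2)] agree by auto
    qed
    also have "\<dots> \<le> (2 * real q) powr (\<gamma> * real r) * (real n * exp (- \<eta> / 8)) ^ r"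
    proof (intro mult_mono power_mono)
      have "(2 * real q) ^ (g - 1) = (2 * real q) powr real (g - 1)" using A by (simp add: powr_realpow)
      also have "\<dots> \<le> (2 * real q) powr (\<gamma> * real r)" using A g g1 by (intro powr_mono) auto
      finally show "(2 * real q) ^ (g - 1) \<le> (2 * real q) powr (\<gamma> * real r)" .
      \<comment> \<open>Forbidden variables lose weight 1 and those outside \<open>C\<close> at
        least 1/2, apart from the contribution of \<open>U\<close>: a loss of at least
        \<open>\<eta> * n / 4\<close> against a gain of at most
        \<open>\<eta> * n / 8\<close>.\<close>
      have "real (card (C - B)) + real q * real (card U) + real (card ?R) / 2 \<le> real n * (1 - \<eta> / 8)"
        using U V cC cR cn by (simp add: algebra_simps)
      also have "\<dots> \<le> real n * exp (- \<eta> / 8)"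
        using exp_ge_add_one_self[of "- \<eta> / 8"] by (intro mult_left_mono) auto
      finally show "real (card (C - B)) + real q * real (card U) + real (card ?R) / 2 \<le> real n * exp (- \<eta> / 8)" .
    qed auto
    finally show ?thesis by (simp add: X_def)
  qed

  have "card S2 \<le> card (\<Union>K\<in>Pow M. {w \<in> S2. N w = K})"
    using finM S1 by (intro card_mono) (auto simp: S2_def N_def)
  also have "\<dots> \<le> (\<Sum>K\<in>Pow M. card {w \<in> S2. N w = K})" using finM by (intro card_UN_le) auto
  finally have "fact r * real (card S2) \<le> fact r * (\<Sum>K\<in>Pow M. real (card {w \<in> S2. N w = K}))"
    by (intro mult_left_mono) (simp_all flip: of_nat_sum)
  also have "\<dots> = (\<Sum>K\<in>Pow M. fact r * real (card {w \<in> S2. N w = K}))" by (rule sum_distrib_left)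
  also have "\<dots> \<le> real (card (Pow M)) * X" using per_class by (intro sum_bounded_above) auto
  also have "real (card (Pow M)) = 2 powr real (card M)" using finM by (simp add: card_Pow powr_realpow)
  also have "2 powr real (card M) * X \<le> 2 powr (real n / (\<gamma> * real r)) * X"
    using Mg \<gamma> r X0 by (intro mult_right_mono powr_mono) (auto simp: r_def pos_le_divide_eq)
  finally have "fact r * real (card S2) \<le> 2 powr (real n / (\<gamma> * real r)) * X" .
  moreover have "fact r * (real (card S) / 4) \<le> fact r * real (card S2)"
    using S2_large by (intro mult_left_mono) auto
  ultimately have "fact r * real (card S) \<le> 4 * (2 powr (real n / (\<gamma> * real r)) * X)"
    by linarith
  then show ?thesis by (simp only: X_def r_def mult.assoc)
qed

section \<open>Growth of \<open>rho\<close>, binomial coefficients and the number of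
  vertices\<close>

text \<open>The iterated logarithm makes \<open>rho n ^ 2\<close> outgrow \<open>n\<close>, so that
  the exponent \<open>n / (\<gamma> * rho n)\<close> counting classes is a small fraction of
  \<open>rho n\<close>.\<close>

lemma rho_asymptotics:
  fixes a b c :: real
  assumes "a > 0" and "b > 0"
  shows "eventually (\<lambda>n. sqrt (real n) \<le> real (rho n) \<and> real (rho n) * 2 \<le> real n \<and>
     real (rho n) \<le> a * real n \<and> real n \<le> b * real (rho n) ^ 2 \<and> c \<le> real (rho n)) sequentially"
proof -
  define x where "x = (\<lambda>n::nat. sqrt (real n) * log 2 (log 2 (real n)))"
  \<comment> \<open>The floor lies between \<open>x n - 1\<close> and \<open>x n\<close>, so lower
    bounds are proved for the former and upper bounds for the latter.\<close>
  have 1: "eventually (\<lambda>n. sqrt (real n) \<le> x n - 1) sequentially" unfolding x_def by real_asymp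
  have 2: "eventually (\<lambda>n. x n * 2 \<le> real n) sequentially" unfolding x_def by real_asymp
  have 3: "eventually (\<lambda>n. x n \<le> a * real n) sequentially" unfolding x_def using assms by real_asymp
  have 4: "eventually (\<lambda>n. real n \<le> b * (x n - 1) ^ 2) sequentially" unfolding x_def using assms by real_asymp
  have 5: "eventually (\<lambda>n. c \<le> x n - 1) sequentially" unfolding x_def by real_asymp
  have 6: "eventually (\<lambda>n. 1 \<le> x n) sequentially" unfolding x_def by real_asymp
  from 1 2 3 4 5 6 show ?thesis
  proof eventually_elim
    case (elim n)
    have "x n - 1 \<le> real (rho n)" "real (rho n) \<le> x n" using elim(6) unfolding rho_def x_def by linarith+
    moreover have "b * (x n - 1) ^ 2 \<le> b * real (rho n) ^ 2"
      using calculation assms elim(6) by (intro mult_left_mono power_mono) auto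
    ultimately show ?case using elim by linarith
  qed
qed

text \<open>For \<open>r \<le> n\<close> the right side is the falling factorial, whose
  \<open>r\<close> factors are all at least \<open>n - r\<close>; otherwise truncated subtraction
  makes the left side 0.\<close>

lemma power_diff_le_fact_mult_binomial: "(n - r) ^ r \<le> fact r * (n choose r)"
proof (induction r arbitrary: n)
  case (Suc r)
  show ?case
  proof (cases n)
    case (Suc m)
    have "(n - Suc r) ^ Suc r = (m - r) * (m - r) ^ r" by (simp add: Suc)
    also have "\<dots> \<le> Suc m * (fact r * (m choose r))" using Suc.IH[of m] by (intro mult_mono) auto
    also have "\<dots> = fact r * (Suc m * (m choose r))" by (simp only: mult_ac)
    also have "\<dots> = fact (Suc r) * (n choose Suc r)"
      unfolding Suc Suc_times_binomial[symmetric] by (simp only: fact_Suc of_nat_id mult_ac)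
    finally show ?thesis .
  qed simp
qed simp

lemma card_G_V:
  assumes "finite A"
  shows "card (G_V n A) = (n choose rho n) * card A ^ rho n"
proof -
  have "G_V n A = (SIGMA T:{T. T \<subseteq> {0..<n} \<and> card T = rho n}. PiE T (\<lambda>_. A))"
    by (auto simp: G_V_def)
  also have "card \<dots> = (\<Sum>T | T \<subseteq> {0..<n} \<and> card T = rho n. card (PiE T (\<lambda>_. A)))"
    using assms by (intro card_SigmaI) (auto intro!: finite_PiE intro: finite_subset)
  also have "\<dots> = (\<Sum>T | T \<subseteq> {0..<n} \<and> card T = rho n. card A ^ rho n)"
    by (intro sum.cong) (auto simp: card_PiE dest: finite_subset)
  also have "\<dots> = (n choose rho n) * card A ^ rho n"
    using n_subsets[of "{0..<n}" "rho n"] by simp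
  finally show ?thesis .
qed

text \<open>The number of vertices lies between \<open>2 ^ r\<close> and \<open>n ^ (2 * r)\<close>.
  Hence its logarithm is at most \<open>2 * r * log 2 n\<close>, its iterated logarithm at least
  half of \<open>log 2 n\<close>, and their quotient at most \<open>4 * r\<close>.\<close>

lemma card_G_V_powr_ge:
  fixes \<epsilon> :: real
  assumes A: "finite A" "card A = q" "q \<ge> 1" "q \<le> n" and n: "n \<ge> 2"
    and r: "sqrt (real n) \<le> real (rho n)" "2 * real (rho n) \<le> real n" and \<epsilon>: "\<epsilon> > 0"
  shows "2 powr (- 4 * \<epsilon> * real (rho n))
    \<le> real (card (G_V n A)) powr (- \<epsilon> / log 2 (log 2 (real (card (G_V n A)))))"
proof -
  define r where "r = rho n"
  define V where "V = real (card (G_V n A))"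
  have V: "V = real (n choose r) * real q ^ r" using card_G_V[OF A(1), of n] A(2) by (simp add: V_def r_def)
  have sq: "sqrt (real n) > 0" using n by simp
  then have r0: "real r > 0" using r(1) unfolding r_def by linarith
  have rn: "r \<le> n" using r(2) unfolding r_def by linarith
  have ln: "log 2 (real n) > 0" using n by simp
  have "real n ^ r * real n ^ r \<ge> V"
    unfolding V using binomial_le_pow[OF rn] A by (intro mult_mono power_mono) (simp_all flip: of_nat_power)
  then have Vup: "V \<le> real n ^ (2 * r)" by (simp flip: power_add mult_2)
  have "2 ^ r \<le> (real n / real r) ^ r"
    using r(2) r0 by (intro power_mono) (auto simp: r_def field_simps)
  also have "\<dots> \<le> real (n choose r)" using binomial_ge_n_over_k_pow_k[OF rn, where 'a = real] by simp
  also have "\<dots> * 1 \<le> V" unfolding V using A by (intro mult_left_mono) auto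
  finally have Vlow: "2 ^ r \<le> V" by simp
  then have V0: "V > 0" by (rule less_le_trans[rotated]) simp
  have "log 2 V \<le> log 2 (real n ^ (2 * r))" using Vup V0 n by (subst log_le_cancel_iff) auto
  then have lup: "log 2 V \<le> 2 * real r * log 2 (real n)" using n by (simp add: log_nat_power)
  have "log 2 (2 ^ r) \<le> log 2 V" using Vlow V0 by (subst log_le_cancel_iff) auto
  then have llow: "sqrt (real n) \<le> log 2 V" using r(1) by (simp add: r_def log_nat_power)
  define L where "L = log 2 (log 2 V)"
  have "log 2 (sqrt (real n)) \<le> L"
    unfolding L_def using llow sq less_le_trans[OF sq llow] by (subst log_le_cancel_iff) auto
  moreover have "log 2 (sqrt (real n)) = log 2 (real n) / 2"
    using n by (simp add: log_def ln_sqrt)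
  ultimately have L: "log 2 (real n) / 2 \<le> L" by simp
  then have L0: "L > 0" using ln by linarith
  have "log 2 V \<le> 4 * real r * (log 2 (real n) / 2)" using lup by simp
  also have "\<dots> \<le> 4 * real r * L" using L by (intro mult_left_mono) auto
  finally have "log 2 V / L \<le> 4 * real r" using L0 by (simp add: pos_divide_le_eq)
  then have "\<epsilon> * (log 2 V / L) \<le> \<epsilon> * (4 * real r)" using \<epsilon> by (intro mult_left_mono) auto
  then have "2 powr (- 4 * \<epsilon> * real r) \<le> 2 powr (log 2 V * (- \<epsilon> / L))"
    by (intro powr_mono) (auto simp: mult_ac)
  also have "\<dots> = (2 powr log 2 V) powr (- \<epsilon> / L)" by (simp add: powr_powr)
  also have "\<dots> = V powr (- \<epsilon> / L)" using V0 by simp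
  finally show ?thesis by (simp add: V_def r_def L_def)
qed

section \<open>Comparison of the lower and upper bounds\<close>

text \<open>After taking logarithms and cancelling \<open>n ^ r\<close>, count in units of
  \<open>\<eta> * r / 64\<close>. The lower side is at least -3: two units for the binomial
  coefficient, one for the exponent \<open>\<eta> / 256\<close>. The upper side is below -8 + 3,
  since \<open>ln 4\<close>, the classes and the rare variables cost at most one unit each;
  \<open>\<gamma>\<close> is chosen for the last.\<close>

lemma asymptotic_contradiction:
  fixes \<eta> \<gamma> c s :: real
  assumes \<eta>: "\<eta> > 0" and q: "q \<ge> 1" and \<gamma>: "\<gamma> = \<eta> / (64 * ln (2 * real q))" and n: "n > 0"
    and small: "real r \<le> (1 - exp (- \<eta> / 32)) * real n"
    and large: "real n \<le> \<gamma> * \<eta> / 64 * real r ^ 2" "65 * ln 4 / \<eta> + 1 \<le> real r"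
    and low: "real (n choose r) * 2 powr (- 4 * (\<eta> / 256) * real r) \<le> s"
    and up: "fact r * s \<le> 4 * 2 powr (real n / (\<gamma> * real r))
      * (2 * real q) powr (\<gamma> * real r) * (real n * exp (- \<eta> / 8)) ^ r"
  shows False
proof -
  have lq: "ln (2 * real q) > 0" using q by (intro ln_gt_zero) auto
  have \<gamma>0: "\<gamma> > 0" using \<gamma> \<eta> lq by simp
  have r0: "real r > 0"
  proof -
    have "65 * ln 4 / \<eta> \<ge> 0" using \<eta> by simp
    then show ?thesis using large(2) by linarith
  qed
  have "real n * exp (- \<eta> / 32) \<le> real n - real r" using small by (simp add: algebra_simps)
  also have "\<dots> \<le> real (n - r)" by linarith
  finally have "(real n * exp (- \<eta> / 32)) ^ r \<le> real (n - r) ^ r" by (intro power_mono) auto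
  also have "\<dots> \<le> fact r * real (n choose r)"
    using of_nat_mono[OF power_diff_le_fact_mult_binomial[of n r], where 'a = real] by simp
  finally have "(real n * exp (- \<eta> / 32)) ^ r * 2 powr (- 4 * (\<eta> / 256) * real r)
      \<le> fact r * real (n choose r) * 2 powr (- 4 * (\<eta> / 256) * real r)"
    by (intro mult_right_mono) auto
  also have "\<dots> \<le> fact r * s" using low by (simp only: mult.assoc) (intro mult_left_mono, auto)
  also note up
  finally have "real n ^ r * (exp (- \<eta> / 32) ^ r * 2 powr (- 4 * (\<eta> / 256) * real r))
      \<le> real n ^ r * (4 * 2 powr (real n / (\<gamma> * real r)) * (2 * real q) powr (\<gamma> * real r) * exp (- \<eta> / 8) ^ r)"
    by (simp add: power_mult_distrib mult_ac)
  then have main: "exp (- \<eta> / 32) ^ r * 2 powr (- 4 * (\<eta> / 256) * real r)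
      \<le> 4 * 2 powr (real n / (\<gamma> * real r)) * (2 * real q) powr (\<gamma> * real r) * exp (- \<eta> / 8) ^ r"
    using n by simp
  have "exp (- \<eta> / 32) ^ r * 2 powr (- 4 * (\<eta> / 256) * real r)
      = exp (- \<eta> / 32 * real r + - 4 * (\<eta> / 256) * real r * ln 2)"
    by (simp add: exp_of_nat_mult[symmetric] powr_def exp_add[symmetric] mult_ac)
  moreover have "4 * 2 powr (real n / (\<gamma> * real r)) * (2 * real q) powr (\<gamma> * real r) * exp (- \<eta> / 8) ^ r
      = exp (ln 4 + real n / (\<gamma> * real r) * ln 2 + \<gamma> * real r * ln (2 * real q) + - \<eta> / 8 * real r)"
    unfolding exp_add using q by (simp add: powr_def flip: exp_of_nat2_mult)
  ultimately have ineq: "- \<eta> / 32 * real r + - 4 * (\<eta> / 256) * real r * ln 2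
      \<le> ln 4 + real n / (\<gamma> * real r) * ln 2 + \<gamma> * real r * ln (2 * real q) + - \<eta> / 8 * real r"
    using main by simp
  have l2: "0 < ln (2::real)" "ln (2::real) \<le> 1" using ln_2_less_1 by auto
  have e1: "\<eta> * real r * ln 2 \<le> \<eta> * real r * 1" using l2 \<eta> by (intro mult_left_mono) auto
  have e2: "\<gamma> * real r * ln (2 * real q) = \<eta> * real r / 64" using lq by (simp add: \<gamma>)
  have "real n / (\<gamma> * real r) \<le> \<eta> * real r / 64"
    using large(1) \<gamma>0 r0 by (simp add: pos_divide_le_eq power2_eq_square mult_ac)
  moreover have "real n / (\<gamma> * real r) * ln 2 \<le> real n / (\<gamma> * real r) * 1"
    using l2 \<gamma>0 by (intro mult_left_mono) auto
  ultimately have e3: "real n / (\<gamma> * real r) * ln 2 \<le> \<eta> * real r / 64" by linarith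
  have "\<eta> * (65 * ln 4 / \<eta> + 1) \<le> \<eta> * real r" using large(2) \<eta> by (intro mult_left_mono) auto
  then have "65 * ln 4 + \<eta> \<le> \<eta> * real r" using \<eta> by (simp add: distrib_left)
  moreover have "ln (4::real) > 0" by simp
  ultimately have e4: "64 * ln 4 < \<eta> * real r" using \<eta> by linarith
  define U where "U = real n / (\<gamma> * real r) * ln 2"
  define G where "G = \<gamma> * real r * ln (2 * real q)"
  have "- (\<eta> * real r) / 32 - (\<eta> * real r * ln 2) / 64 \<le> ln 4 + U + G - \<eta> * real r / 8"
    using ineq[folded U_def G_def] by (simp add: mult_ac)
  moreover have "\<eta> * real r * ln 2 \<le> \<eta> * real r" using e1 by simp
  \<comment> \<open>Naming the products leaves a purely linear contradiction.\<close>
  moreover have False if "- a / 32 - b / 64 \<le> l + U + G - a / 8" "b \<le> a" "G = a / 64" "U \<le> a / 64" "64 * l < a" "a > 0"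
    for a b l :: real
    using that by linarith
  ultimately show False using e2[folded G_def] e3[folded U_def] e4 mult_pos_pos[OF \<eta> r0] by blast
qed


section \<open>Choice of the constants and conclusion\<close>

theorem mainTheorem2:
  fixes \<eta> :: real and q d :: nat
  assumes "\<eta> > 0" and "q \<ge> 1" and "d \<ge> 1"
  shows "\<exists>\<epsilon>0 > 0. \<exists>\<delta> > 0. \<exists>N. \<forall>n \<ge> N. \<forall>A Ec psi.
           finite A \<and> card A = q \<and> csp_wf n Ec \<and> constraint_graph_regular n Ec d \<and>
           csp_OPT n A Ec psi < 1 - \<eta> \<longrightarrow>
           (\<forall>S \<subseteq> G_V n A.
              card S = nat \<lceil>real (n choose rho n) *
                 real (card (G_V n A)) powr (- \<epsilon>0 / log 2 (log 2 (real (card (G_V n A)))))\<rceil>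
              \<longrightarrow> den S (G_E n A Ec psi) < 1 - \<delta>)"
proof -
  define \<gamma> where "\<gamma> = \<eta> / (64 * ln (2 * real q))"
  define \<delta> where "\<delta> = \<eta> * \<gamma> / (64 * real q)"
  have "ln (2 * real q) > 0" using assms by (intro ln_gt_zero) auto
  then have \<gamma>: "\<gamma> > 0" using assms by (simp add: \<gamma>_def)
  then have \<delta>: "\<delta> > 0" using assms by (simp add: \<delta>_def)
  have "1 - exp (- \<eta> / 32) > 0" "\<gamma> * \<eta> / 64 > 0" using assms \<gamma> by auto
  from rho_asymptotics[OF this, of "65 * ln 4 / \<eta> + 1"]
  obtain N0 where N0: "\<And>n. n \<ge> N0 \<Longrightarrow> sqrt (real n) \<le> real (rho n) \<and> real (rho n) * 2 \<le> real n \<and>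
     real (rho n) \<le> (1 - exp (- \<eta> / 32)) * real n \<and> real n \<le> \<gamma> * \<eta> / 64 * real (rho n) ^ 2 \<and>
     65 * ln 4 / \<eta> + 1 \<le> real (rho n)"
    unfolding eventually_sequentially by blast
  \<comment> \<open>Besides \<open>N0\<close>, the threshold includes \<open>q\<close>, so that
    \<open>q ^ r \<le> n ^ r\<close> in the vertex count, and 2, so that \<open>log 2 n\<close> is
    positive.\<close>
  have "den S (G_E n A Ec psi) < 1 - \<delta>"
    if n: "n \<ge> max N0 (max q 2)" and A: "finite A" "card A = q" and wf: "csp_wf n Ec"
      and reg: "constraint_graph_regular n Ec d" and opt: "csp_OPT n A Ec psi < 1 - \<eta>" and S: "S \<subseteq> G_V n A"
      and cS: "card S = nat \<lceil>real (n choose rho n) *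
        real (card (G_V n A)) powr (- (\<eta> / 256) / log 2 (log 2 (real (card (G_V n A)))))\<rceil>"
    for n A Ec psi S
  proof (rule ccontr)
    assume "\<not> ?thesis"
    then have den: "den S (G_E n A Ec psi) \<ge> 1 - \<delta>" by simp
    have r: "sqrt (real n) \<le> real (rho n)" "2 * real (rho n) \<le> real n"
        "real (rho n) \<le> (1 - exp (- \<eta> / 32)) * real n" "real n \<le> \<gamma> * \<eta> / 64 * real (rho n) ^ 2"
        "65 * ln 4 / \<eta> + 1 \<le> real (rho n)"
      using N0[of n] n by auto
    have rn: "rho n \<le> n" using r(2) by linarith
    have "sqrt (real n) > 0" using n by simp
    then have r0: "rho n > 0" using r(1) by linarith
    have "2 powr (- 4 * (\<eta> / 256) * real (rho n))
      \<le> real (card (G_V n A)) powr (- (\<eta> / 256) / log 2 (log 2 (real (card (G_V n A)))))"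
      using A assms n r by (intro card_G_V_powr_ge[of A q]) auto
    then have "real (n choose rho n) * 2 powr (- 4 * (\<eta> / 256) * real (rho n))
      \<le> real (n choose rho n) * real (card (G_V n A)) powr (- (\<eta> / 256) / log 2 (log 2 (real (card (G_V n A)))))"
      by (intro mult_left_mono) auto
    \<comment> \<open>Rounding the size up preserves the lower bound.\<close>
    also have "\<dots> \<le> real (card S)" unfolding cS by linarith
    finally have low: "real (n choose rho n) * 2 powr (- 4 * (\<eta> / 256) * real (rho n)) \<le> real (card S)" .
    have "real (n choose rho n) * 2 powr (- 4 * (\<eta> / 256) * real (rho n)) > 0" using rn by simp
    then have S0: "card S > 0" using low by linarith
    have up: "fact (rho n) * real (card S) \<le> 4 * 2 powr (real n / (\<gamma> * real (rho n)))
        * (2 * real q) powr (\<gamma> * real (rho n)) * (real n * exp (- \<eta> / 8)) ^ rho n"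
      using n assms(3) by (intro card_dense_set_le[OF A assms(2) wf reg _ _ opt \<gamma> assms(1) r0 \<delta>_def S den S0]) auto
    show False
      using n by (intro asymptotic_contradiction[OF assms(1,2) \<gamma>_def _ r(3,4,5) low up]) auto
  qed
  then show ?thesis using assms(1) \<delta>
    by (intro exI[of _ "\<eta> / 256"] exI[of _ \<delta>] exI[of _ "max N0 (max q 2)"] conjI allI impI) auto
qed

end
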